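(* (Heisenberg system.) Let $m>0$ and let $U$ be a smooth function of $\mathbf q=(q_1,q_2)\in\mathbb{R}^2$. Consider the mass point in $\mathbb{R}^3$ with Lagrangian $L=\frac12m(\dot q_1^2+\dot q_2^2+\dot q_3^2)-U(\mathbf q)$ and nonholonomic constraint $\dot q_3-q_2\dot q_1+q_1\dot q_2=0$, and its reduced system in the variables $(\mathbf q,\mathbf P)\in\mathbb{R}^4$ (see context). Then: (1) The reduced system has the invariant measure $\mathcal N(\mathbf q)\,d\mathbf q\,d\mathbf P$ with $\mathcal N(\mathbf q)=(q_1^2+q_2^2+1)^{-1}$. (2) In the variables $(\mathbf q,\mathbf p)$, $\mathbf p=\mathcal N(\mathbf q)\mathbf P$, the equations of motion take the conformally Hamiltonian form $\dot q_i=\mathcal N\frac{\partial\overline H}{\partial p_i}$, $\dot p_i=-\mathcal N\frac{\partial\overline H}{\partial q_i}$, $i=1,2$ (canonical Poisson bracket), with Hamiltonian $$\overline H=\frac{1+q_1^2+q_2^2}{2m}\bigl((q_1p_1+q_2p_2)^2+p_1^2+p_2^2\bigr)+U(\mathbf q).$$ (3) For $\mathbf q\neq0$, let $\theta\in(0,\frac\pi2)$, $\varphi\in[0,2\pi)$ be defined by the central projection $q_1=\tan\theta\cos\varphi$, $q_2=\tan\theta\sin\varphi$. The canonically conjugate momenta are $$p_\theta=\frac{1+q_1^2+q_2^2}{\sqrt{q_1^2+q_2^2}}(q_1p_1+q_2p_2),\qquad p_\varphi=q_1p_2-q_2p_1,$$ and in these variables the Hamiltonian becomes that of a mass point on the sphere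 $S^2$ in a potential field: $$H^{(s)}=\frac{p_\theta^2}{2m}+\frac{p_\varphi^2}{2m\sin^2\theta}+V(\theta,\varphi),\qquad V(\theta,\varphi)=U(q_1(\theta,\varphi),q_2(\theta,\varphi)).$$
   Context: For the constraint $\dot q_3=a_1(\mathbf q)\dot q_1+a_2(\mathbf q)\dot q_2$ let $L^*$ be $L$ with $\dot q_3$ eliminated by the constraint, $S=\left(\frac{\partial L}{\partial\dot q_3}\right)^{*}\left(\frac{\partial a_1}{\partial q_2}-\frac{\partial a_2}{\partial q_1}\right)$ (with $(\cdot)^*$ meaning that $\dot q_3$ is eliminated by the constraint after differentiation), $P_i=\partial L^*/\partial\dot q_i$ ($i=1,2$), $H=P_1\dot q_1+P_2\dot q_2-L^*$ as a function of $(\mathbf q,\mathbf P)$. The reduced system is $$\dot q_i=\frac{\partial H}{\partial P_i},\quad \dot P_1=-\frac{\partial H}{\partial q_1}+\frac{\partial H}{\partial P_2}S,\quad \dot P_2=-\frac{\partial H}{\partial q_2}-\frac{\partial H}{\partial P_1}S .$$ A measure $\mathcal N\,d\mathbf q\,d\mathbf P$ is invariant if $\operatorname{div}(\mathcal N\mathbf v)=0$ for the vector field $\mathbf v$ of this system. Here $a_1=q_2$, $a_2=-q_1$. *)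

theory Defs
  imports "HOL-Analysis.Analysis"
begin

definition partial :: "'n::finite \<Rightarrow> (real^'n \<Rightarrow> real) \<Rightarrow> real^'n \<Rightarrow> real" where
  "partial i f x = deriv (\<lambda>s. f (x + s *\<^sub>R axis i 1)) 0"

primrec C_k :: "nat \<Rightarrow> (real^'n::finite \<Rightarrow> real) \<Rightarrow> bool" where
  "C_k 0 f \<longleftrightarrow> continuous_on UNIV f"
| "C_k (Suc k) f \<longleftrightarrow> f differentiable_on UNIV \<and> (\<forall>i. C_k k (partial i f))"

definition smooth :: "(real^'n::finite \<Rightarrow> real) \<Rightarrow> bool" where
  "smooth f \<longleftrightarrow> (\<forall>k. C_k k f)"

text \<open>Legendre transform of a Lagrangian \<open>Lag q v\<close>. The map \<open>v \<mapsto> P\<close> has to be invertible;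
  otherwise \<open>inv\<close> returns an arbitrary preimage or an unspecified velocity.\<close>

definition momentum :: "(real^'n::finite \<Rightarrow> real^'n \<Rightarrow> real) \<Rightarrow> real^'n \<Rightarrow> real^'n \<Rightarrow> real^'n" where
  "momentum Lag q v = (\<chi> i. partial i (Lag q) v)"

definition velocity :: "(real^'n::finite \<Rightarrow> real^'n \<Rightarrow> real) \<Rightarrow> real^'n \<Rightarrow> real^'n \<Rightarrow> real^'n" where
  "velocity Lag q P = inv (momentum Lag q) P"

definition hamiltonian :: "(real^'n::finite \<Rightarrow> real^'n \<Rightarrow> real) \<Rightarrow> real^'n \<Rightarrow> real^'n \<Rightarrow> real" where
  "hamiltonian Lag q P = P \<bullet> velocity Lag q P - Lag q (velocity Lag q P)"

text \<open>Lagrangians \<open>L q w\<close> of the unreduced system do not depend on the third coordinate, so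
  \<open>q\<close> is the pair of the first two coordinates, while \<open>w\<close> has all three velocities.\<close>

definition constrained_velocity ::
    "(real^2 \<Rightarrow> real) \<Rightarrow> (real^2 \<Rightarrow> real) \<Rightarrow> real^2 \<Rightarrow> real^2 \<Rightarrow> real^3" where
  "constrained_velocity a1 a2 q v = vector [v$1, v$2, a1 q * v$1 + a2 q * v$2]"

definition L_star ::
    "(real^2 \<Rightarrow> real^3 \<Rightarrow> real) \<Rightarrow> (real^2 \<Rightarrow> real) \<Rightarrow> (real^2 \<Rightarrow> real) \<Rightarrow> real^2 \<Rightarrow> real^2 \<Rightarrow> real" where
  "L_star L a1 a2 q v = L q (constrained_velocity a1 a2 q v)"

definition S_term ::
    "(real^2 \<Rightarrow> real^3 \<Rightarrow> real) \<Rightarrow> (real^2 \<Rightarrow> real) \<Rightarrow> (real^2 \<Rightarrow> real) \<Rightarrow> real^2 \<Rightarrow> real^2 \<Rightarrow> real" where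
  "S_term L a1 a2 q v =
     partial 3 (L q) (constrained_velocity a1 a2 q v) * (partial 2 a1 q - partial 1 a2 q)"

definition reduced_field ::
    "(real^2 \<Rightarrow> real^3 \<Rightarrow> real) \<Rightarrow> (real^2 \<Rightarrow> real) \<Rightarrow> (real^2 \<Rightarrow> real)
      \<Rightarrow> (real^2) \<times> (real^2) \<Rightarrow> (real^2) \<times> (real^2)" where
  "reduced_field L a1 a2 = (\<lambda>(q, P).
     let H = hamiltonian (L_star L a1 a2);
         S = S_term L a1 a2 q (velocity (L_star L a1 a2) q P)
     in (vector [partial 1 (H q) P, partial 2 (H q) P],
         vector [- partial 1 (\<lambda>q'. H q' P) q + partial 2 (H q) P * S,
                 - partial 2 (\<lambda>q'. H q' P) q - partial 1 (H q) P * S]))"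

definition divergence ::
    "((real^'n::finite) \<times> (real^'n) \<Rightarrow> (real^'n) \<times> (real^'n)) \<Rightarrow> (real^'n) \<times> (real^'n) \<Rightarrow> real" where
  "divergence F = (\<lambda>(q, P).
     (\<Sum>i\<in>UNIV. partial i (\<lambda>q'. fst (F (q', P)) $ i) q) +
     (\<Sum>i\<in>UNIV. partial i (\<lambda>P'. snd (F (q, P')) $ i) P))"

text \<open>Differentiability is required because \<open>deriv\<close> is unspecified where no derivative exists.\<close>

definition invariant_density ::
    "((real^'n::finite) \<times> (real^'n) \<Rightarrow> real) \<Rightarrow>
     ((real^'n) \<times> (real^'n) \<Rightarrow> (real^'n) \<times> (real^'n)) \<Rightarrow> bool" where
  "invariant_density N F \<longleftrightarrow>
     (\<lambda>x. N x *\<^sub>R F x) differentiable_on UNIV \<and> (\<forall>x. divergence (\<lambda>x. N x *\<^sub>R F x) x = 0)"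

definition solves :: "('a::real_normed_vector \<Rightarrow> 'a) \<Rightarrow> real set \<Rightarrow> (real \<Rightarrow> 'a) \<Rightarrow> bool" where
  "solves F T \<gamma> \<longleftrightarrow> (\<forall>t\<in>T. (\<gamma> has_vector_derivative F (\<gamma> t)) (at t))"

definition conformal_field ::
    "(real^'n::finite \<Rightarrow> real) \<Rightarrow> (real^'n \<Rightarrow> real^'n \<Rightarrow> real)
      \<Rightarrow> (real^'n) \<times> (real^'n) \<Rightarrow> (real^'n) \<times> (real^'n)" where
  "conformal_field N H = (\<lambda>(q, p).
     (\<chi> i. N q * partial i (H q) p, \<chi> i. - N q * partial i (\<lambda>q'. H q' p) q))"

text \<open>For a change of coordinates \<open>q = f x\<close>, the momenta \<open>y\<close> canonically conjugate to \<open>x\<close> are those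
  with \<open>y \<cdot> dx = p \<cdot> dq\<close>, i.e. the canonical one-form is preserved.\<close>

definition conjugate_momenta ::
    "(real^'n::finite \<Rightarrow> real^'n) \<Rightarrow> real^'n \<Rightarrow> real^'n \<Rightarrow> real^'n \<Rightarrow> bool" where
  "conjugate_momenta f x p y \<longleftrightarrow>
     f differentiable (at x) \<and> (\<forall>v. y \<bullet> v = p \<bullet> frechet_derivative f (at x) v)"

definition heis_L :: "real \<Rightarrow> (real^2 \<Rightarrow> real) \<Rightarrow> real^2 \<Rightarrow> real^3 \<Rightarrow> real" where
  "heis_L m U q w = 1/2 * m * ((w$1)\<^sup>2 + (w$2)\<^sup>2 + (w$3)\<^sup>2) - U q"

text \<open>The constraint is \<open>w$3 - q$2 * w$1 + q$1 * w$2 = 0\<close>.\<close>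

definition heis_field :: "real \<Rightarrow> (real^2 \<Rightarrow> real) \<Rightarrow> (real^2) \<times> (real^2) \<Rightarrow> (real^2) \<times> (real^2)" where
  "heis_field m U = reduced_field (heis_L m U) (\<lambda>q. q$2) (\<lambda>q. - q$1)"

definition heis_N :: "real^2 \<Rightarrow> real" where
  "heis_N q = inverse ((q$1)\<^sup>2 + (q$2)\<^sup>2 + 1)"

definition heis_H :: "real \<Rightarrow> (real^2 \<Rightarrow> real) \<Rightarrow> real^2 \<Rightarrow> real^2 \<Rightarrow> real" where
  "heis_H m U q p = (1 + (q$1)\<^sup>2 + (q$2)\<^sup>2) / (2 * m) *
     ((q$1 * p$1 + q$2 * p$2)\<^sup>2 + (p$1)\<^sup>2 + (p$2)\<^sup>2) + U q"

text \<open>Spherical coordinates are \<open>x = (\<theta>, \<phi>)\<close>; \<open>central_proj x\<close> is the point where the ray through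
  \<open>sphere_point x\<close> meets the plane of height 1 (its first two coordinates).\<close>

definition central_proj :: "real^2 \<Rightarrow> real^2" where
  "central_proj x = vector [tan (x$1) * cos (x$2), tan (x$1) * sin (x$2)]"

definition sphere_point :: "real^2 \<Rightarrow> real^3" where
  "sphere_point x = vector [sin (x$1) * cos (x$2), sin (x$1) * sin (x$2), cos (x$1)]"

definition sphere_lagrangian :: "real \<Rightarrow> (real^2 \<Rightarrow> real) \<Rightarrow> real^2 \<Rightarrow> real^2 \<Rightarrow> real" where
  "sphere_lagrangian m V x v =
     1/2 * m * (norm (frechet_derivative sphere_point (at x) v))\<^sup>2 - V x"

end

(* Eliminating the third velocity gives a kinetic energy quadratic in (v1, v2), whose Legendre
   transform is H = (|P|^2 + (q.P)^2) / (2mG) + U with G = 1 + |q|^2 = 1/N. With the field explicit,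
   the q-divergence of N v is -(q.P)/(mG^2), and the gyroscopic S-terms make the P-divergence its
   negative. Since q.q' = (q.P)/m, differentiating p = P/G produces exactly the terms that turn the
   equations for P into N times Hamilton's equations for p. On the sphere, 1 + tan^2 = 1/cos^2 and
   |p|^2 = A^2 + B^2 with A, B the radial and tangential components of p. *)
theory Submission
  imports Defs
begin

section \<open>Derivative rules for explicit vectors, pairs and scaled curves\<close>

lemma vector_2_eq_axis: "(vector [a, b] :: real^2) = a *\<^sub>R axis 1 1 + b *\<^sub>R axis 2 1"
  by (simp add: vec_eq_iff forall_2 axis_def)

text \<open>As a sum of scaled basis vectors, \<open>vector\<close> falls under the standard rules
  for sums and \<open>scaleR\<close>; the derivative rules below rest on this.\<close>

lemma vector_3_eq_axis:
  "(vector [a, b, c] :: real^3) = a *\<^sub>R axis 1 1 + b *\<^sub>R axis 2 1 + c *\<^sub>R axis 3 1"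
  by (simp add: vec_eq_iff forall_3 axis_def)

lemma vector_2_eq_iff: "(x :: 'a::zero^2) = vector [a, b] \<longleftrightarrow> x$1 = a \<and> x$2 = b"
  by (simp add: vec_eq_iff forall_2)

lemma inner_real_2: "(x :: real^2) \<bullet> y = x$1 * y$1 + x$2 * y$2"
  by (simp add: inner_vec_def sum_2)

lemma differentiable_vec_nth [derivative_intros]:
  assumes "f differentiable F"
  shows "(\<lambda>x. f x $ i) differentiable F"
  using assms bounded_linear.has_derivative[OF bounded_linear_vec_nth]
  unfolding differentiable_def by blast

lemma differentiable_vector_2 [derivative_intros]:
  assumes "f differentiable (at x within A)" "g differentiable (at x within A)"
  shows "(\<lambda>x. vector [f x, g x] :: real^2) differentiable (at x within A)"
  unfolding vector_2_eq_axis using assms by simp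

lemma has_derivative_vector_2 [derivative_intros]:
  assumes "(f has_derivative f') F" "(g has_derivative g') F"
  shows "((\<lambda>x. vector [f x, g x] :: real^2) has_derivative (\<lambda>h. vector [f' h, g' h])) F"
  unfolding vector_2_eq_axis by (intro derivative_intros assms)

lemma has_derivative_vector_3 [derivative_intros]:
  assumes "(f has_derivative f') F" "(g has_derivative g') F" "(k has_derivative k') F"
  shows "((\<lambda>x. vector [f x, g x, k x] :: real^3) has_derivative
    (\<lambda>h. vector [f' h, g' h, k' h])) F"
  unfolding vector_3_eq_axis by (intro derivative_intros assms)

lemmas has_derivative_vec_nth [derivative_intros] =
  bounded_linear.has_derivative[OF bounded_linear_vec_nth]

text \<open>Both projections are bounded linear. Keeping \<open>c\<close> as one variable lets the
  value of a vector field on phase space be inserted directly.\<close>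

lemma has_vector_derivative_Pair_iff:
  "((\<lambda>t. (f t, g t)) has_vector_derivative c) (at x) \<longleftrightarrow>
    (f has_vector_derivative fst c) (at x) \<and> (g has_vector_derivative snd c) (at x)"
  using bounded_linear.has_vector_derivative[OF bounded_linear_fst,
      of "\<lambda>t. (f t, g t)" c "at x"]
    bounded_linear.has_vector_derivative[OF bounded_linear_snd,
      of "\<lambda>t. (f t, g t)" c "at x"]
    has_vector_derivative_Pair[of f "fst c" x UNIV g "snd c"]
  by auto

text \<open>Scaling by \<open>inverse (r s)\<close> undoes scaling by \<open>r s\<close>, so the
  product rule can be read in both directions. It is applied with \<open>r\<close> the density along
  a curve, to pass between \<open>P\<close> and \<open>p\<close>.\<close>

lemma has_vector_derivative_scaleR_iff:
  fixes f :: "real \<Rightarrow> 'a::real_normed_vector"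
  assumes r: "(r has_real_derivative r') (at t)" and nz: "\<And>s. r s \<noteq> 0"
  shows "((\<lambda>s. r s *\<^sub>R f s) has_vector_derivative r t *\<^sub>R f' + r' *\<^sub>R f t) (at t)
    \<longleftrightarrow> (f has_vector_derivative f') (at t)" (is "?L \<longleftrightarrow> ?R")
proof
  assume ?L
  have "((\<lambda>s. inverse (r s)) has_real_derivative - (inverse (r t) * r' * inverse (r t))) (at t)"
    using r nz by (auto intro!: derivative_eq_intros)
  from has_vector_derivative_scaleR[OF this \<open>?L\<close>]
  have "((\<lambda>s. inverse (r s) *\<^sub>R r s *\<^sub>R f s) has_vector_derivative f') (at t)"
    using nz[of t] by (simp add: scaleR_add_right mult.assoc)
  then show ?R
    using nz by simp
next
  assume ?R
  from has_vector_derivative_scaleR[OF r this] show ?L .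
qed

section \<open>Partial derivatives, smoothness and inversion of the momentum map\<close>

lemma partial_eqI:
  assumes "((\<lambda>s. f (x + s *\<^sub>R axis i 1)) has_real_derivative D) (at 0)"
  shows "partial i f x = D"
  unfolding partial_def by (rule DERIV_imp_deriv[OF assms])

lemma differentiable_partial:
  assumes "f differentiable (at x)"
  shows "((\<lambda>s. f (x + s *\<^sub>R axis i 1)) has_real_derivative partial i f x) (at 0)"
proof -
  \<comment> \<open>The base point is written as the inner function's value at 0, the form that the
    chain rule expects.\<close>
  obtain f' where f': "(f has_derivative f') (at (x + 0 *\<^sub>R axis i 1))"
    using assms by (auto simp: differentiable_def)
  have "((\<lambda>s. x + s *\<^sub>R axis i (1::real)) has_derivative (\<lambda>h. h *\<^sub>R axis i 1)) (at 0)"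
    by (auto intro!: derivative_eq_intros)
  from diff_chain_at[OF this f'] have "(\<lambda>s. f (x + s *\<^sub>R axis i 1)) differentiable (at 0)"
    unfolding comp_def differentiable_def by blast
  then show ?thesis
    unfolding partial_def
    by (simp add: DERIV_deriv_iff_real_differentiable)
qed

text \<open>Two orders are extracted: the first to differentiate the Hamiltonian, the second because
  the field contains \<open>partial i U\<close> and must itself be differentiable.\<close>

lemma smooth_differentiable:
  assumes "smooth f"
  shows "f differentiable (at x)" "partial i f differentiable (at x)"
proof -
  have "C_k 2 f"
    using assms by (simp add: smooth_def)
  then show "f differentiable (at x)" "partial i f differentiable (at x)"
    by (auto simp: numeral_2_eq_2 differentiable_on_def)
qed

text \<open>The left inverse makes the momentum map injective, so \<open>inv\<close> has no choice
  of preimage; the second premise says that \<open>P\<close> is attained.\<close>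

lemma velocity_eqI:
  assumes "\<And>v. g (momentum Lag q v) = v" "momentum Lag q (g P) = P"
  shows "velocity Lag q P = g P"
  unfolding velocity_def using assms by (metis injI inv_f_eq)

section \<open>Legendre transform of the constrained Lagrangian\<close>

abbreviation heis_G :: "real^2 \<Rightarrow> real" where
  "heis_G q \<equiv> (q$1)\<^sup>2 + (q$2)\<^sup>2 + 1"

lemma heis_G_pos: "heis_G q > 0"
  by (simp add: add_nonneg_pos)

lemma heis_G_nz: "heis_G q \<noteq> 0"
  using heis_G_pos[of q] by simp

abbreviation heis_Lstar :: "real \<Rightarrow> (real^2 \<Rightarrow> real) \<Rightarrow> real^2 \<Rightarrow> real^2 \<Rightarrow> real" where
  "heis_Lstar m U \<equiv> L_star (heis_L m U) (\<lambda>q. q$2) (\<lambda>q. - q$1)"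

lemma heis_Lstar_eq:
  "heis_Lstar m U q v = 1/2 * m * ((v$1)\<^sup>2 + (v$2)\<^sup>2 + (q$2 * v$1 - q$1 * v$2)\<^sup>2) - U q"
  by (simp add: L_star_def heis_L_def constrained_velocity_def)

lemma heis_momentum:
  "momentum (heis_Lstar m U) q v =
    vector [m * (v$1 + q$2 * (q$2 * v$1 - q$1 * v$2)), m * (v$2 - q$1 * (q$2 * v$1 - q$1 * v$2))]"
proof -
  have "partial 1 (heis_Lstar m U q) v = m * (v$1 + q$2 * (q$2 * v$1 - q$1 * v$2))"
    unfolding heis_Lstar_eq
    by (rule partial_eqI) (auto intro!: derivative_eq_intros simp: axis_def field_simps)
  moreover have "partial 2 (heis_Lstar m U q) v = m * (v$2 - q$1 * (q$2 * v$1 - q$1 * v$2))"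
    unfolding heis_Lstar_eq
    by (rule partial_eqI) (auto intro!: derivative_eq_intros simp: axis_def field_simps)
  ultimately show ?thesis
    by (simp add: momentum_def vector_2_eq_iff)
qed

text \<open>With w = (q2, -q1) the mass matrix is m (I + w w^T). Its inverse is (G I - w w^T) / (m
  G), and w w^T + q q^T = |q|^2 I turns the numerator into I + q q^T.\<close>

lemma heis_velocity:
  assumes "m > 0"
  shows "velocity (heis_Lstar m U) q P =
    vector [(P$1 + q$1 * (q \<bullet> P)) / (m * heis_G q), (P$2 + q$2 * (q \<bullet> P)) / (m * heis_G q)]"
proof (rule velocity_eqI)
  have nz: "m \<noteq> 0" "heis_G q \<noteq> 0" "m * heis_G q \<noteq> 0"
    using assms heis_G_nz by auto
  let ?P = "momentum (heis_Lstar m U) q"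
  show "vector [(?P v $ 1 + q$1 * (q \<bullet> ?P v)) / (m * heis_G q),
      (?P v $ 2 + q$2 * (q \<bullet> ?P v)) / (m * heis_G q)] = v" for v
    unfolding heis_momentum inner_real_2 eq_commute[of _ v] vector_2_eq_iff vector_2
    using nz(3) by (auto simp: eq_divide_eq power2_eq_square algebra_simps)
  show "?P (vector [(P$1 + q$1 * (q \<bullet> P)) / (m * heis_G q),
      (P$2 + q$2 * (q \<bullet> P)) / (m * heis_G q)]) = P"
    unfolding heis_momentum inner_real_2 eq_commute[of _ P] vector_2_eq_iff vector_2
    using nz by (auto simp: divide_simps) (auto simp: power2_eq_square algebra_simps)
qed

text \<open>The kinetic energy is quadratic in the velocity, so P.v is twice its value by Euler's
  identity and H = P.v / 2 + U. Inserting the velocity gives the formula.\<close>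

lemma heis_hamiltonian:
  assumes "m > 0"
  shows "hamiltonian (heis_Lstar m U) q P = (P \<bullet> P + (q \<bullet> P)\<^sup>2) / (2 * m * heis_G q) + U q"
proof -
  have nz: "m \<noteq> 0" "heis_G q \<noteq> 0"
    using assms heis_G_nz by auto
  define v where "v = velocity (heis_Lstar m U) q P"
  have v: "P$1 = m * (v$1 + q$2 * (q$2 * v$1 - q$1 * v$2))"
    "P$2 = m * (v$2 - q$1 * (q$2 * v$1 - q$1 * v$2))"
    "v$1 * (m * heis_G q) = P$1 + q$1 * (q \<bullet> P)" "v$2 * (m * heis_G q) = P$2 + q$2 * (q \<bullet> P)"
    unfolding v_def heis_velocity[OF assms] vector_2 inner_real_2
    using nz by (auto simp: divide_simps) (auto simp: power2_eq_square algebra_simps)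
  have "hamiltonian (heis_Lstar m U) q P =
      P$1 * v$1 + P$2 * v$2 - 1/2 * m * ((v$1)\<^sup>2 + (v$2)\<^sup>2 + (q$2 * v$1 - q$1 * v$2)\<^sup>2) + U q"
    by (simp add: hamiltonian_def v_def[symmetric] heis_Lstar_eq inner_real_2)
  also have "\<dots> = (P$1 * v$1 + P$2 * v$2) / 2 + U q"
    unfolding v(1,2) by (simp add: field_simps power2_eq_square)
  also have "P$1 * v$1 + P$2 * v$2 = (P \<bullet> P + (q \<bullet> P)\<^sup>2) / (m * heis_G q)"
  proof -
    have "(P$1 * v$1 + P$2 * v$2) * (m * heis_G q) =
        P$1 * (v$1 * (m * heis_G q)) + P$2 * (v$2 * (m * heis_G q))"
      by (simp add: algebra_simps)
    also have "\<dots> = P \<bullet> P + (q \<bullet> P)\<^sup>2"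
      unfolding v(3,4) by (simp add: inner_real_2 power2_eq_square algebra_simps)
    finally show ?thesis
      using nz by (simp add: eq_divide_eq)
  qed
  finally show ?thesis
    by simp
qed

section \<open>The reduced vector field in explicit form\<close>

definition heis_qdot :: "real \<Rightarrow> 2 \<Rightarrow> real^2 \<Rightarrow> real^2 \<Rightarrow> real" where
  "heis_qdot m i q P = (P$i + q$i * (q$1 * P$1 + q$2 * P$2)) / (m * heis_G q)"

text \<open>Minus the derivative of the kinetic part of H in \<open>q$i\<close>, as given by the
  quotient rule; the potential is kept apart.\<close>

definition heis_force :: "real \<Rightarrow> 2 \<Rightarrow> real^2 \<Rightarrow> real^2 \<Rightarrow> real" where
  "heis_force m i q P = - (q$1 * P$1 + q$2 * P$2) * P$i / (m * heis_G q)
     + ((P$1)\<^sup>2 + (P$2)\<^sup>2 + (q$1 * P$1 + q$2 * P$2)\<^sup>2) * q$i / (m * (heis_G q)\<^sup>2)"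

definition heis_S :: "real^2 \<Rightarrow> real^2 \<Rightarrow> real" where
  "heis_S q P = 2 * (q$2 * P$1 - q$1 * P$2) / heis_G q"

text \<open>The curl factor is 1 - (-1) = 2. In the third velocity q2 v1 - q1 v2 the terms with q.P
  cancel, leaving (q2 P1 - q1 P2) / (m G).\<close>

lemma heis_S_eq:
  assumes "m > 0"
  shows "S_term (heis_L m U) (\<lambda>q. q$2) (\<lambda>q. - q$1) q (velocity (heis_Lstar m U) q P) = heis_S q P"
proof -
  have nz: "m \<noteq> 0" "heis_G q \<noteq> 0"
    using assms heis_G_nz by auto
  have "partial 3 (heis_L m U q) w = m * w$3" for w
    unfolding heis_L_def
    by (rule partial_eqI) (auto intro!: derivative_eq_intros simp: axis_def algebra_simps)
  moreover have "partial 2 (\<lambda>q. q$2) q = 1" "partial 1 (\<lambda>q. - q$1) q = -1"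
    by (rule partial_eqI, auto intro!: derivative_eq_intros simp: axis_def)+
  ultimately show ?thesis
    using nz
    by (simp add: S_term_def constrained_velocity_def heis_velocity[OF assms] heis_S_def inner_real_2)
      (auto simp: divide_simps, auto simp: power2_eq_square algebra_simps)
qed

lemma heis_field_eq:
  assumes "m > 0" "smooth U"
  shows "heis_field m U (q, P) =
    (vector [heis_qdot m 1 q P, heis_qdot m 2 q P],
     vector [heis_force m 1 q P - partial 1 U q + heis_qdot m 2 q P * heis_S q P,
             heis_force m 2 q P - partial 2 U q - heis_qdot m 1 q P * heis_S q P])"
proof -
  have nz: "m \<noteq> 0" "heis_G q \<noteq> 0"
    using assms heis_G_nz by auto
  have P: "partial i (hamiltonian (heis_Lstar m U) q) P = heis_qdot m i q P" for i
  proof (rule partial_eqI)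
    \<comment> \<open>The numerator of the kinetic energy along a coordinate line, with components
      spelled out so that both values of \<open>i\<close> are treated together.\<close>
    define n where "n s = (P$1 + s * axis i 1 $ 1)\<^sup>2 + (P$2 + s * axis i 1 $ 2)\<^sup>2
      + (q$1 * (P$1 + s * axis i 1 $ 1) + q$2 * (P$2 + s * axis i 1 $ 2))\<^sup>2" for s
    have "(n has_real_derivative 2 * (P$i + q$i * (q$1 * P$1 + q$2 * P$2))) (at 0)"
      unfolding n_def using exhaust_2[of i]
      by (auto intro!: derivative_eq_intros simp: axis_def algebra_simps)
    then have "((\<lambda>s. n s / (2 * m * heis_G q) + U q) has_real_derivative
        2 * (P$i + q$i * (q$1 * P$1 + q$2 * P$2)) / (2 * m * heis_G q) + 0) (at 0)"
      by (intro DERIV_add DERIV_cdivide DERIV_const)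
    also have "2 * (P$i + q$i * (q$1 * P$1 + q$2 * P$2)) / (2 * m * heis_G q) + 0 = heis_qdot m i q P"
      \<comment> \<open>The factor 2 must stay undistributed in order to cancel against
        \<open>2 * m\<close>.\<close>
      by (simp add: heis_qdot_def mult.assoc del: distrib_left_numeral)
    finally show "((\<lambda>s. hamiltonian (heis_Lstar m U) q (P + s *\<^sub>R axis i 1))
        has_real_derivative heis_qdot m i q P) (at 0)"
      by (simp add: heis_hamiltonian[OF assms(1)] inner_real_2 n_def power2_eq_square)
  qed
  have q: "partial i (\<lambda>q. hamiltonian (heis_Lstar m U) q P) q = - heis_force m i q P + partial i U q" for i
  proof (rule partial_eqI)
    define n where "n s = (P$1)\<^sup>2 + (P$2)\<^sup>2
      + ((q$1 + s * axis i 1 $ 1) * P$1 + (q$2 + s * axis i 1 $ 2) * P$2)\<^sup>2" for s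
    define d where "d s = heis_G (q + s *\<^sub>R axis i 1)" for s
    have n: "(n has_real_derivative 2 * (q$1 * P$1 + q$2 * P$2) * P$i) (at 0)"
      unfolding n_def using exhaust_2[of i] by (auto intro!: derivative_eq_intros simp: axis_def)
    have d: "(d has_real_derivative 2 * q$i) (at 0)"
      unfolding d_def using exhaust_2[of i] by (auto intro!: derivative_eq_intros simp: axis_def)
    have "((\<lambda>s. n s / d s / (2 * m)) has_real_derivative
        (2 * (q$1 * P$1 + q$2 * P$2) * P$i * d 0 - n 0 * (2 * q$i)) / (d 0 * d 0) / (2 * m)) (at 0)"
      using heis_G_nz by (intro DERIV_cdivide DERIV_divide n d) (simp add: d_def)
    also have "(2 * (q$1 * P$1 + q$2 * P$2) * P$i * d 0 - n 0 * (2 * q$i)) / (d 0 * d 0) / (2 * m)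
        = - heis_force m i q P"
    proof -
      \<comment> \<open>Stated over atoms, so that \<open>heis_G q\<close> is not expanded while
        denominators are cleared.\<close>
      have *: "(2 * T * p * D - A * (2 * x)) / (D * D) / (2 * m) =
          - (- T * p / (m * D) + A * x / (m * D\<^sup>2))"
        if "D \<noteq> 0" for T p D A x :: real
        using that nz(1) by (simp add: power2_eq_square divide_simps)
      have 0: "n 0 = (P$1)\<^sup>2 + (P$2)\<^sup>2 + (q$1 * P$1 + q$2 * P$2)\<^sup>2" "d 0 = heis_G q"
        by (simp_all add: n_def d_def)
      show ?thesis
        unfolding heis_force_def 0 by (rule *[OF nz(2)])
    qed
    finally have "((\<lambda>s. n s / d s / (2 * m) + U (q + s *\<^sub>R axis i 1)) has_real_derivative
        - heis_force m i q P + partial i U q) (at 0)"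
      by (intro DERIV_add differentiable_partial smooth_differentiable assms)
    moreover have "hamiltonian (heis_Lstar m U) (q + s *\<^sub>R axis i 1) P =
        n s / d s / (2 * m) + U (q + s *\<^sub>R axis i 1)" for s
      unfolding heis_hamiltonian[OF assms(1)] inner_real_2 n_def d_def
      by (simp add: power2_eq_square mult.commute)
    ultimately show "((\<lambda>s. hamiltonian (heis_Lstar m U) (q + s *\<^sub>R axis i 1) P) has_real_derivative
        - heis_force m i q P + partial i U q) (at 0)"
      by presburger
  qed
  show ?thesis
    unfolding heis_field_def reduced_field_def Let_def
    by (simp add: P q heis_S_eq assms vector_2_eq_iff algebra_simps)
qed

section \<open>Invariance of the measure\<close>

lemma partial_N_qdot:
  assumes "m \<noteq> 0"
  shows "partial i (\<lambda>q. heis_N q * heis_qdot m i q P) q =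
    (q$1 * P$1 + q$2 * P$2 + q$i * P$i) / (m * (heis_G q)\<^sup>2)
    - 4 * q$i * (P$i + q$i * (q$1 * P$1 + q$2 * P$2)) / (m * (heis_G q)^3)"
proof (rule partial_eqI)
  define n where "n s = P$i + (q$i + s) * ((q$1 + s * axis i 1 $ 1) * P$1 + (q$2 + s * axis i 1 $ 2) * P$2)" for s
  define d where "d s = heis_G (q + s *\<^sub>R axis i 1)" for s
  have n: "(n has_real_derivative q$1 * P$1 + q$2 * P$2 + q$i * P$i) (at 0)"
    unfolding n_def using exhaust_2[of i] by (auto intro!: derivative_eq_intros simp: axis_def)
  have d: "(d has_real_derivative 2 * q$i) (at 0)"
    unfolding d_def using exhaust_2[of i] by (auto intro!: derivative_eq_intros simp: axis_def)
  have 0: "n 0 = P$i + q$i * (q$1 * P$1 + q$2 * P$2)" "d 0 = heis_G q"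
    by (simp_all add: n_def d_def)
  \<comment> \<open>The density contributes a second factor 1/G, hence the squared
    denominator.\<close>
  have "((\<lambda>s. n s / (d s * d s) / m) has_real_derivative
      ((q$1 * P$1 + q$2 * P$2 + q$i * P$i) * (d 0 * d 0) - n 0 * (2 * q$i * d 0 + 2 * q$i * d 0))
        / (d 0 * d 0 * (d 0 * d 0)) / m) (at 0)"
    using heis_G_nz by (intro DERIV_cdivide DERIV_divide DERIV_mult n d) (simp add: d_def)
  also have "((q$1 * P$1 + q$2 * P$2 + q$i * P$i) * (d 0 * d 0) - n 0 * (2 * q$i * d 0 + 2 * q$i * d 0))
        / (d 0 * d 0 * (d 0 * d 0)) / m = (q$1 * P$1 + q$2 * P$2 + q$i * P$i) / (m * (heis_G q)\<^sup>2)
    - 4 * q$i * (P$i + q$i * (q$1 * P$1 + q$2 * P$2)) / (m * (heis_G q)^3)"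
  proof -
    have *: "(a * (D * D) - b * (2 * x * D + 2 * x * D)) / (D * D * (D * D)) / m =
        a / (m * D\<^sup>2) - 4 * x * b / (m * D^3)" if "D \<noteq> 0" for a b x D :: real
      using that assms by (simp add: power2_eq_square power3_eq_cube divide_simps) (simp add: algebra_simps)
    show ?thesis
      unfolding 0 by (rule *[OF heis_G_nz])
  qed
  finally show "((\<lambda>s. heis_N (q + s *\<^sub>R axis i 1) * heis_qdot m i (q + s *\<^sub>R axis i 1) P)
      has_real_derivative
      (q$1 * P$1 + q$2 * P$2 + q$i * P$i) / (m * (heis_G q)\<^sup>2)
      - 4 * q$i * (P$i + q$i * (q$1 * P$1 + q$2 * P$2)) / (m * (heis_G q)^3)) (at 0)"
    by (simp add: heis_N_def heis_qdot_def n_def d_def axis_def divide_inverse mult_ac)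
qed

text \<open>Here \<open>c\<close> stands for the derivative of \<open>U\<close>, which is constant
  in \<open>P\<close>. The last two terms on each right-hand side are the product rule applied to
  the gyroscopic term.\<close>

lemma partial_N_force:
  defines "T \<equiv> \<lambda>q P :: real^2. q$1 * P$1 + q$2 * P$2"
  shows "partial 1 (\<lambda>P. heis_N q * (heis_force m 1 q P - c + heis_qdot m 2 q P * heis_S q P)) P =
      heis_N q * (- (T q P + q$1 * P$1) / (m * heis_G q) + 2 * (P$1 + q$1 * T q P) * q$1 / (m * (heis_G q)\<^sup>2)
        + q$1 * q$2 / (m * heis_G q) * heis_S q P + heis_qdot m 2 q P * (2 * q$2 / heis_G q))" (is ?A)
    and "partial 2 (\<lambda>P. heis_N q * (heis_force m 2 q P - c - heis_qdot m 1 q P * heis_S q P)) P =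
      heis_N q * (- (T q P + q$2 * P$2) / (m * heis_G q) + 2 * (P$2 + q$2 * T q P) * q$2 / (m * (heis_G q)\<^sup>2)
        - q$1 * q$2 / (m * heis_G q) * heis_S q P + heis_qdot m 1 q P * (2 * q$1 / heis_G q))" (is ?B)
proof -
  \<comment> \<open>These inverses do not involve the momenta; frozen as constants they leave
    polynomials in \<open>P\<close> to differentiate.\<close>
  define k l g where "k = inverse (m * heis_G q)" "l = inverse (m * (heis_G q)\<^sup>2)" "g = inverse (heis_G q)"
  note defs = heis_force_def heis_qdot_def heis_S_def divide_inverse T_def k_l_g_def[symmetric]
  show ?A
    unfolding defs by (rule partial_eqI) (auto intro!: derivative_eq_intros simp: axis_def algebra_simps)
  show ?B
    unfolding defs by (rule partial_eqI) (auto intro!: derivative_eq_intros simp: axis_def algebra_simps)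
qed

text \<open>In the polynomial identities \<open>k\<close> and \<open>n\<close> stand for the inverses of \<open>heis_G q\<close> and \<open>m\<close>;
  keeping the inverses atomic avoids clearing denominators.\<close>

lemma heis_divergence_polynomial:
  fixes a b x y k n :: real
  shows "(a * x + b * y + a * x) * (n * k\<^sup>2) - 4 * a * (x + a * (a * x + b * y)) * (n * k ^ 3)
    + ((a * x + b * y + b * y) * (n * k\<^sup>2) - 4 * b * (y + b * (a * x + b * y)) * (n * k ^ 3))
    + (k * (- (a * x + b * y + a * x) * (n * k) + 2 * (x + a * (a * x + b * y)) * a * (n * k\<^sup>2)
        + a * b * (n * k) * (2 * (b * x - a * y) * k)
        + (y + b * (a * x + b * y)) * (n * k) * (2 * b * k))
      + k * (- (a * x + b * y + b * y) * (n * k) + 2 * (y + b * (a * x + b * y)) * b * (n * k\<^sup>2)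
        - a * b * (n * k) * (2 * (b * x - a * y) * k)
        + (x + a * (a * x + b * y)) * (n * k) * (2 * a * k))) = 0"
  by (simp add: power2_eq_square power3_eq_cube algebra_simps)

lemma heis_divergence_identity:
  fixes m :: real and q P :: "real^2"
  defines "T \<equiv> q$1 * P$1 + q$2 * P$2"
  shows "(T + q$1 * P$1) / (m * (heis_G q)\<^sup>2) - 4 * q$1 * (P$1 + q$1 * T) / (m * (heis_G q)^3)
    + ((T + q$2 * P$2) / (m * (heis_G q)\<^sup>2) - 4 * q$2 * (P$2 + q$2 * T) / (m * (heis_G q)^3))
    + (heis_N q * (- (T + q$1 * P$1) / (m * heis_G q) + 2 * (P$1 + q$1 * T) * q$1 / (m * (heis_G q)\<^sup>2)
        + q$1 * q$2 / (m * heis_G q) * heis_S q P + heis_qdot m 2 q P * (2 * q$2 / heis_G q))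
      + heis_N q * (- (T + q$2 * P$2) / (m * heis_G q) + 2 * (P$2 + q$2 * T) * q$2 / (m * (heis_G q)\<^sup>2)
        - q$1 * q$2 / (m * heis_G q) * heis_S q P + heis_qdot m 1 q P * (2 * q$1 / heis_G q))) = 0"
proof -
  define k where "k = inverse (heis_G q)"
  show ?thesis
    unfolding heis_N_def heis_qdot_def heis_S_def T_def divide_inverse inverse_mult_distrib
      power_inverse[symmetric] k_def[symmetric]
    by (rule heis_divergence_polynomial)
qed

lemma heis_invariant_density:
  assumes m: "m > 0" and U: "smooth U"
  shows "invariant_density (\<lambda>(q, P). heis_N q) (heis_field m U)"
proof -
  have nz: "m \<noteq> 0"
    using m by simp
  \<comment> \<open>Writing the point as \<open>(fst x, snd x)\<close> exposes the pair to which the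
    explicit field formula applies.\<close>
  have "(\<lambda>x. heis_N (fst x) *\<^sub>R heis_field m U (fst x, snd x)) differentiable (at x)" for x
  proof -
    have fst: "fst differentiable (at x)" and snd: "snd differentiable (at x)"
      unfolding differentiable_def
      by (blast intro: bounded_linear_imp_has_derivative bounded_linear_fst bounded_linear_snd)+
    have U': "(\<lambda>x. partial i U (fst x)) differentiable (at x)" for i
      using differentiable_compose[of "partial i U" fst x] smooth_differentiable[OF U] fst by blast
    show ?thesis
      unfolding heis_field_eq[OF m U] heis_N_def heis_force_def heis_qdot_def heis_S_def
      using nz heis_G_nz
      by (intro derivative_intros differentiable_vec_nth differentiable_vector_2 fst snd U') auto
  qed
  then have diff: "(\<lambda>x. (case x of (q, P) \<Rightarrow> heis_N q) *\<^sub>R heis_field m U x) differentiable_on UNIV"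
    by (simp add: differentiable_on_def case_prod_unfold)
  have "divergence (\<lambda>x. (case x of (q, P) \<Rightarrow> heis_N q) *\<^sub>R heis_field m U x) (q, P) = 0" for q P
  proof -
    have "divergence (\<lambda>x. (case x of (q, P) \<Rightarrow> heis_N q) *\<^sub>R heis_field m U x) (q, P) =
        partial 1 (\<lambda>q. heis_N q * heis_qdot m 1 q P) q + partial 2 (\<lambda>q. heis_N q * heis_qdot m 2 q P) q
        + (partial 1 (\<lambda>P. heis_N q * (heis_force m 1 q P - partial 1 U q + heis_qdot m 2 q P * heis_S q P)) P
          + partial 2 (\<lambda>P. heis_N q * (heis_force m 2 q P - partial 2 U q - heis_qdot m 1 q P * heis_S q P)) P)"
      by (simp add: divergence_def sum_2 heis_field_eq[OF m U])
    also have "\<dots> = 0"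
      unfolding partial_N_qdot[OF nz] partial_N_force by (rule heis_divergence_identity)
    finally show ?thesis .
  qed
  then show ?thesis
    unfolding invariant_density_def using diff by auto
qed

section \<open>The conformally Hamiltonian form\<close>

lemma conformal_field_heis:
  assumes "smooth U"
  shows "conformal_field heis_N (heis_H m U) (q, p) =
    (\<chi> i. (p$i + q$i * (q \<bullet> p)) / m,
     \<chi> i. - (q$i * ((q \<bullet> p)\<^sup>2 + p \<bullet> p) / (m * heis_G q)) - (q \<bullet> p) * p$i / m - heis_N q * partial i U q)"
proof -
  have P: "partial i (heis_H m U q) p = heis_G q / m * (p$i + q$i * (q \<bullet> p))" for i
  proof (rule partial_eqI)
    define n where "n s = (q$1 * (p$1 + s * axis i 1 $ 1) + q$2 * (p$2 + s * axis i 1 $ 2))\<^sup>2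
      + (p$1 + s * axis i 1 $ 1)\<^sup>2 + (p$2 + s * axis i 1 $ 2)\<^sup>2" for s
    have "(n has_real_derivative 2 * (p$i + q$i * (q \<bullet> p))) (at 0)"
      unfolding n_def inner_real_2 using exhaust_2[of i]
      by (auto intro!: derivative_eq_intros simp: axis_def algebra_simps)
    then have "((\<lambda>s. (1 + (q$1)\<^sup>2 + (q$2)\<^sup>2) / (2 * m) * n s + U q) has_real_derivative
        (1 + (q$1)\<^sup>2 + (q$2)\<^sup>2) / (2 * m) * (2 * (p$i + q$i * (q \<bullet> p))) + 0) (at 0)"
      by (intro DERIV_add DERIV_cmult DERIV_const)
    then show "((\<lambda>s. heis_H m U q (p + s *\<^sub>R axis i 1)) has_real_derivative
        heis_G q / m * (p$i + q$i * (q \<bullet> p))) (at 0)"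
      by (simp add: heis_H_def n_def add_ac del: distrib_left_numeral)
  qed
  have Q: "partial i (\<lambda>q. heis_H m U q p) q =
      q$i * ((q \<bullet> p)\<^sup>2 + p \<bullet> p) / m + heis_G q * (q \<bullet> p) * p$i / m + partial i U q" for i
  proof (rule partial_eqI)
    define n where "n s = ((q$1 + s * axis i 1 $ 1) * p$1 + (q$2 + s * axis i 1 $ 2) * p$2)\<^sup>2
      + (p$1)\<^sup>2 + (p$2)\<^sup>2" for s
    define d where "d s = 1 + (q$1 + s * axis i 1 $ 1)\<^sup>2 + (q$2 + s * axis i 1 $ 2)\<^sup>2" for s
    have n: "(n has_real_derivative 2 * (q \<bullet> p) * p$i) (at 0)"
      unfolding n_def inner_real_2 using exhaust_2[of i] by (auto intro!: derivative_eq_intros simp: axis_def)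
    have d: "(d has_real_derivative 2 * q$i) (at 0)"
      unfolding d_def using exhaust_2[of i] by (auto intro!: derivative_eq_intros simp: axis_def)
    have 0: "n 0 = (q \<bullet> p)\<^sup>2 + p \<bullet> p" "d 0 = heis_G q"
      by (simp_all add: n_def d_def inner_real_2 power2_eq_square)
    have "((\<lambda>s. d s / (2 * m) * n s + U (q + s *\<^sub>R axis i 1)) has_real_derivative
        2 * q$i / (2 * m) * n 0 + 2 * (q \<bullet> p) * p$i * (d 0 / (2 * m)) + partial i U q) (at 0)"
      by (intro DERIV_add DERIV_mult DERIV_cdivide n d differentiable_partial smooth_differentiable assms)
    moreover have "2 * q$i / (2 * m) * n 0 + 2 * (q \<bullet> p) * p$i * (d 0 / (2 * m)) + partial i U q =
        q$i * ((q \<bullet> p)\<^sup>2 + p \<bullet> p) / m + heis_G q * (q \<bullet> p) * p$i / m + partial i U q"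
    proof -
      have "2 * x / (2 * m) * a + 2 * t * y * (b / (2 * m)) = x * a / m + b * t * y / m" for x a t y b
        by simp
      then show ?thesis
        unfolding 0 by simp
    qed
    ultimately show "((\<lambda>s. heis_H m U (q + s *\<^sub>R axis i 1) p) has_real_derivative
        q$i * ((q \<bullet> p)\<^sup>2 + p \<bullet> p) / m + heis_G q * (q \<bullet> p) * p$i / m + partial i U q) (at 0)"
      by (simp add: heis_H_def n_def d_def)
  qed
  show ?thesis
  proof -
    \<comment> \<open>The density cancels the prefactor G of the Hamiltonian; only the term from
      differentiating that prefactor keeps a factor 1/G.\<close>
    have 1: "inverse G * (G / m * x) = x / m"
      and 2: "- inverse G * (a / m + G * b * c / m + u) = - (a / (m * G)) - b * c / m - inverse G * u"
      if "G \<noteq> 0" for G x a b c u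
      using that by (simp_all add: divide_inverse algebra_simps)
    show ?thesis
      unfolding conformal_field_def prod.case P Q heis_N_def 1[OF heis_G_nz] 2[OF heis_G_nz] ..
  qed
qed

text \<open>Here \<open>a\<close>, \<open>b\<close> and \<open>x\<close>, \<open>y\<close> are the
  components of \<open>q\<close> and \<open>P\<close>, and \<open>u\<close> is a derivative of
  \<open>U\<close>. The premise says k = 1/G: it reduces q.q' = n k G (q.P) to n (q.P) in the last
  term, after which the powers of \<open>k\<close> match.\<close>

lemma heis_pdot_polynomial:
  fixes a b x y k n u :: real
  assumes "k * (a\<^sup>2 + b\<^sup>2 + 1) = 1"
  shows "- (a * ((a * (k * x) + b * (k * y))\<^sup>2 + (k * x * (k * x) + k * y * (k * y))) * (n * k))
      - (a * (k * x) + b * (k * y)) * (k * x) * n - k * u =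
    k * (- (a * x + b * y) * x * (n * k) + (x\<^sup>2 + y\<^sup>2 + (a * x + b * y)\<^sup>2) * a * (n * k\<^sup>2) - u
        + (y + b * (a * x + b * y)) * (n * k) * (2 * (b * x - a * y) * k))
      + - 2 * (a * ((x + a * (a * x + b * y)) * (n * k)) + b * ((y + b * (a * x + b * y)) * (n * k))) * k\<^sup>2 * x"
    and "- (b * ((a * (k * x) + b * (k * y))\<^sup>2 + (k * x * (k * x) + k * y * (k * y))) * (n * k))
      - (a * (k * x) + b * (k * y)) * (k * y) * n - k * u =
    k * (- (a * x + b * y) * y * (n * k) + (x\<^sup>2 + y\<^sup>2 + (a * x + b * y)\<^sup>2) * b * (n * k\<^sup>2) - u
        - (x + a * (a * x + b * y)) * (n * k) * (2 * (b * x - a * y) * k))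
      + - 2 * (a * ((x + a * (a * x + b * y)) * (n * k)) + b * ((y + b * (a * x + b * y)) * (n * k))) * k\<^sup>2 * y"
  using assms by algebra+

text \<open>The coefficient of \<open>P\<close> in the second identity is the time derivative of the
  density along the flow, so that identity is the product rule for p = N P.\<close>

lemma heis_fields_related:
  assumes m: "m > 0" and U: "smooth U"
  defines "F \<equiv> \<lambda>q P. heis_field m U (q, P)"
    and "C \<equiv> \<lambda>q p. conformal_field heis_N (heis_H m U) (q, p)"
  shows "fst (C q (heis_N q *\<^sub>R P)) = fst (F q P)"
    and "snd (C q (heis_N q *\<^sub>R P)) =
      heis_N q *\<^sub>R snd (F q P) + (- 2 * (q \<bullet> fst (F q P)) * (heis_N q)\<^sup>2) *\<^sub>R P"
proof -
  define k where "k = inverse (heis_G q)"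
  have k: "k * ((q$1)\<^sup>2 + (q$2)\<^sup>2 + 1) = 1"
    unfolding k_def using heis_G_nz by simp
  note defs = C_def F_def heis_field_eq[OF m U] conformal_field_heis[OF U] fst_conv snd_conv
    vec_eq_iff forall_2 vec_lambda_beta vector_2 vector_add_component vector_scaleR_component
    heis_qdot_def heis_force_def heis_S_def heis_N_def inner_real_2 real_scaleR_def
    divide_inverse inverse_mult_distrib power_inverse[symmetric] k_def[symmetric]
  show "fst (C q (heis_N q *\<^sub>R P)) = fst (F q P)"
    unfolding defs by (simp add: algebra_simps)
  show "snd (C q (heis_N q *\<^sub>R P)) =
      heis_N q *\<^sub>R snd (F q P) + (- 2 * (q \<bullet> fst (F q P)) * (heis_N q)\<^sup>2) *\<^sub>R P"
    unfolding defs by (intro conjI heis_pdot_polynomial k)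
qed

text \<open>The equivalence holds at each time separately: the density depends on \<open>q\<close>
  alone and never vanishes.\<close>

lemma heis_solves_iff:
  assumes m: "m > 0" and U: "smooth U"
  shows "solves (heis_field m U) T (\<lambda>t. (q t, P t)) \<longleftrightarrow>
    solves (conformal_field heis_N (heis_H m U)) T (\<lambda>t. (q t, heis_N (q t) *\<^sub>R P t))"
proof -
  define F where "F q P = heis_field m U (q, P)" for q P
  define C where "C q p = conformal_field heis_N (heis_H m U) (q, p)" for q p
  note rel = heis_fields_related[OF m U, folded F_def C_def]
  have N_deriv: "((\<lambda>s. heis_N (q s)) has_real_derivative - 2 * (q t \<bullet> q') * (heis_N (q t))\<^sup>2) (at t)"
    if "(q has_vector_derivative q') (at t)" for q' t
  proof -
    have q: "((\<lambda>s. q s $ i) has_real_derivative q' $ i) (at t)" for i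
      using bounded_linear.has_vector_derivative[OF bounded_linear_vec_nth that]
      by (simp add: has_real_derivative_iff_has_vector_derivative)
    show ?thesis
      unfolding heis_N_def using heis_G_nz
      by (auto intro!: derivative_eq_intros q simp: inner_real_2 power2_eq_square algebra_simps)
  qed
  have "((\<lambda>t. (q t, P t)) has_vector_derivative F (q t) (P t)) (at t) \<longleftrightarrow>
    ((\<lambda>t. (q t, heis_N (q t) *\<^sub>R P t)) has_vector_derivative C (q t) (heis_N (q t) *\<^sub>R P t)) (at t)" for t
  proof -
    have "heis_N q \<noteq> 0" for q
      by (simp add: heis_N_def heis_G_nz)
    then show ?thesis
      \<comment> \<open>After \<open>rel\<close> both sides contain the same equation for
        \<open>q\<close>, which supplies the derivative of the density for the scaling rule.\<close>
      unfolding has_vector_derivative_Pair_iff rel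
      using has_vector_derivative_scaleR_iff[OF N_deriv] by blast
  qed
  then show ?thesis
    by (simp add: solves_def F_def C_def)
qed

section \<open>Central projection and the sphere\<close>

lemma central_proj_norm: "(central_proj x $ 1)\<^sup>2 + (central_proj x $ 2)\<^sup>2 = (tan (x$1))\<^sup>2"
  by (simp add: central_proj_def power_mult_distrib flip: distrib_left)

text \<open>These are polar coordinates with radius tan \<theta>: \<open>arctan\<close> recovers
  \<theta>, and the unit vector q / r determines the angle in its half-open range.\<close>

lemma central_proj_bij:
  fixes q :: "real^2"
  assumes "q \<noteq> 0"
  shows "\<exists>!x :: real^2. 0 < x$1 \<and> x$1 < pi/2 \<and> 0 \<le> x$2 \<and> x$2 < 2*pi \<and> q = central_proj x"
proof -
  define r where "r = sqrt ((q$1)\<^sup>2 + (q$2)\<^sup>2)"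
  have "q$1 \<noteq> 0 \<or> q$2 \<noteq> 0"
    using assms by (auto simp: vec_eq_iff forall_2)
  then have "r > 0"
    by (simp add: r_def sum_power2_gt_zero_iff)
  have r: "r\<^sup>2 = (q$1)\<^sup>2 + (q$2)\<^sup>2"
    by (simp add: r_def)
  have "(q$1 / r)\<^sup>2 + (q$2 / r)\<^sup>2 = 1"
    using \<open>r > 0\<close> by (simp add: power_divide flip: add_divide_distrib r)
  then obtain t where t: "0 \<le> t" "t < 2*pi" "q$1 / r = cos t" "q$2 / r = sin t"
    by (rule sincos_total_2pi)
  show ?thesis
  proof (rule ex1I[of _ "vector [arctan r, t]"])
    show "0 < (vector [arctan r, t] :: real^2)$1 \<and> (vector [arctan r, t] :: real^2)$1 < pi/2 \<and>
        0 \<le> (vector [arctan r, t] :: real^2)$2 \<and> (vector [arctan r, t] :: real^2)$2 < 2*pi \<and>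
        q = central_proj (vector [arctan r, t])"
      using \<open>r > 0\<close> t arctan_ubound[of r] by (auto simp: central_proj_def tan_arctan vector_2_eq_iff field_simps)
  next
    fix x :: "real^2"
    assume x: "0 < x$1 \<and> x$1 < pi/2 \<and> 0 \<le> x$2 \<and> x$2 < 2*pi \<and> q = central_proj x"
    have tan: "tan (x$1) > 0"
      using x by (intro tan_gt_zero) auto
    have q: "q$1 = tan (x$1) * cos (x$2)" "q$2 = tan (x$1) * sin (x$2)"
      using x by (simp_all add: central_proj_def)
    have "r\<^sup>2 = (tan (x$1))\<^sup>2"
      using x by (simp add: r central_proj_norm)
    then have "r = tan (x$1)"
      using \<open>r > 0\<close> tan by (simp add: power2_eq_iff_nonneg)
    then have eq: "x$1 = arctan r" "cos (x$2) = cos t" "sin (x$2) = sin t"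
      using x t(3,4) q \<open>r > 0\<close> by (auto simp: arctan_tan)
    \<comment> \<open>Both angles lie in [0, 2 pi), so they differ by less than a full turn and
      \<open>n\<close> must be 0.\<close>
    from eq(2,3) obtain n :: int where n: "x$2 = t + 2 * pi * n"
      using sin_cos_eq_iff by blast
    have "2 * pi * n < 2 * pi * 1" "2 * pi * (- 1) < 2 * pi * n"
      using x t(1,2) n by linarith+
    moreover have "0 < 2 * pi"
      by simp
    ultimately have "real_of_int n < 1" "- 1 < real_of_int n"
      by (simp_all only: mult_less_cancel_left_pos)
    then have "n = 0"
      by linarith
    then show "x = vector [arctan r, t]"
      using n eq(1) by (simp add: vector_2_eq_iff)
  qed
qed

lemma has_derivative_central_proj:
  assumes "cos (x$1) \<noteq> 0"
  shows "(central_proj has_derivative (\<lambda>v. vector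
    [v$1 * cos (x$2) / (cos (x$1))\<^sup>2 - tan (x$1) * sin (x$2) * v$2,
     v$1 * sin (x$2) / (cos (x$1))\<^sup>2 + tan (x$1) * cos (x$2) * v$2])) (at x)"
  unfolding central_proj_def[abs_def]
  by (rule has_derivative_eq_rhs, (rule derivative_intros assms)+)
    (simp add: fun_eq_iff divide_inverse algebra_simps)

text \<open>The new momenta are the transposed Jacobian applied to \<open>p\<close>, that is, the
  coefficients of \<open>v$1\<close> and \<open>v$2\<close> in its pairing with the
  derivative.\<close>

lemma conjugate_momenta_central_proj:
  assumes "cos (x$1) \<noteq> 0"
  shows "conjugate_momenta central_proj x p (vector
    [(p$1 * cos (x$2) + p$2 * sin (x$2)) / (cos (x$1))\<^sup>2,
     tan (x$1) * (p$2 * cos (x$2) - p$1 * sin (x$2))])"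
  unfolding conjugate_momenta_def
  using has_derivative_central_proj[OF assms] frechet_derivative_at[OF has_derivative_central_proj[OF assms], symmetric]
  by (auto simp: differentiable_def inner_real_2 algebra_simps add_divide_distrib)

text \<open>The embedding induces the round metric d\<theta>^2 + sin^2 \<theta> d\<phi>^2.\<close>

lemma sphere_lagrangian_eq:
  "sphere_lagrangian m V x v = 1/2 * m * ((v$1)\<^sup>2 + (sin (x$1) * v$2)\<^sup>2) - V x"
proof -
  have "(sphere_point has_derivative (\<lambda>v. vector
    [v$1 * cos (x$1) * cos (x$2) - sin (x$1) * sin (x$2) * v$2,
     v$1 * cos (x$1) * sin (x$2) + sin (x$1) * cos (x$2) * v$2,
     - (v$1 * sin (x$1))])) (at x)"
    unfolding sphere_point_def[abs_def]
    by (rule has_derivative_eq_rhs, (rule derivative_intros)+)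
      (simp add: fun_eq_iff algebra_simps)
  note D = frechet_derivative_at[OF this, symmetric]
  have norm3: "(norm w)\<^sup>2 = (w$1)\<^sup>2 + (w$2)\<^sup>2 + (w$3)\<^sup>2" for w :: "real^3"
    unfolding power2_norm_eq_inner inner_vec_def by (simp add: sum_3 power2_eq_square)
  have "(v$1 * cos (x$1) * cos (x$2) - sin (x$1) * sin (x$2) * v$2)\<^sup>2
      + (v$1 * cos (x$1) * sin (x$2) + sin (x$1) * cos (x$2) * v$2)\<^sup>2 + (- (v$1 * sin (x$1)))\<^sup>2
      = (v$1)\<^sup>2 + (sin (x$1) * v$2)\<^sup>2"
    using sin_cos_squared_add[of "x$1"] sin_cos_squared_add[of "x$2"] by algebra
  then show ?thesis
    by (simp add: sphere_lagrangian_def D norm3)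
qed

text \<open>Away from the poles the diagonal metric is nondegenerate, so the momentum map is
  inverted componentwise.\<close>

lemma hamiltonian_sphere:
  assumes "m \<noteq> 0" "sin (x$1) \<noteq> 0"
  shows "hamiltonian (sphere_lagrangian m V) x y =
    (y$1)\<^sup>2 / (2 * m) + (y$2)\<^sup>2 / (2 * m * (sin (x$1))\<^sup>2) + V x"
proof -
  have "partial 1 (sphere_lagrangian m V x) v = m * v$1"
    "partial 2 (sphere_lagrangian m V x) v = m * (sin (x$1))\<^sup>2 * v$2" for v
    unfolding sphere_lagrangian_eq
    by (rule partial_eqI, force intro!: derivative_eq_intros simp: axis_def power2_eq_square field_simps)+
  then have mom: "momentum (sphere_lagrangian m V) x v = vector [m * v$1, m * (sin (x$1))\<^sup>2 * v$2]" for v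
    by (simp add: momentum_def vector_2_eq_iff)
  have "velocity (sphere_lagrangian m V) x y = vector [y$1 / m, y$2 / (m * (sin (x$1))\<^sup>2)]"
    by (rule velocity_eqI) (use assms in \<open>simp_all add: mom vec_eq_iff forall_2\<close>)
  then show ?thesis
    using assms by (simp add: hamiltonian_def sphere_lagrangian_eq inner_real_2)
      (simp add: field_simps power2_eq_square)
qed

text \<open>The radial part acquires 1 + tan^2 twice, giving 1/cos^4; the tangential part acquires
  it once, and 1/cos^2 = tan^2 / sin^2.\<close>

lemma heis_H_spherical:
  assumes "cos (x$1) \<noteq> 0" "sin (x$1) \<noteq> 0"
  shows "heis_H m U (central_proj x) p =
    ((p$1 * cos (x$2) + p$2 * sin (x$2)) / (cos (x$1))\<^sup>2)\<^sup>2 / (2 * m)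
    + (tan (x$1) * (p$2 * cos (x$2) - p$1 * sin (x$2)))\<^sup>2 / (2 * m * (sin (x$1))\<^sup>2) + U (central_proj x)"
proof -
  define A where "A = p$1 * cos (x$2) + p$2 * sin (x$2)"
  define B where "B = p$2 * cos (x$2) - p$1 * sin (x$2)"
  have AB: "(p$1)\<^sup>2 + (p$2)\<^sup>2 = A\<^sup>2 + B\<^sup>2"
    unfolding A_def B_def using sin_cos_squared_add[of "x$2"] by algebra
  have "1 + (tan (x$1))\<^sup>2 = 1 / (cos (x$1))\<^sup>2"
    using tan_sec[OF assms(1)] by (simp add: divide_inverse power_inverse)
  have "heis_H m U (central_proj x) p =
      (1 + (tan (x$1))\<^sup>2) / (2 * m) * ((tan (x$1) * A)\<^sup>2 + (A\<^sup>2 + B\<^sup>2)) + U (central_proj x)"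
    unfolding heis_H_def add.assoc central_proj_norm AB by (simp add: central_proj_def A_def algebra_simps)
  also have "(tan (x$1) * A)\<^sup>2 + (A\<^sup>2 + B\<^sup>2) = A\<^sup>2 * (1 + (tan (x$1))\<^sup>2) + B\<^sup>2"
    by (simp add: algebra_simps)
  also have "(1 + (tan (x$1))\<^sup>2) / (2 * m) * (A\<^sup>2 * (1 + (tan (x$1))\<^sup>2) + B\<^sup>2) =
      (A / (cos (x$1))\<^sup>2)\<^sup>2 / (2 * m) + (tan (x$1) * B)\<^sup>2 / (2 * m * (sin (x$1))\<^sup>2)"
    unfolding \<open>1 + _ = _\<close> using assms
    \<comment> \<open>The mass is arbitrary here; at \<open>m = 0\<close> division by zero makes
      both sides 0.\<close>
    by (cases "m = 0") (auto simp: tan_def field_simps)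
  finally show ?thesis
    by (simp add: A_def B_def)
qed

theorem mainTheorem4:
  fixes m :: real and U :: "real^2 \<Rightarrow> real"
  assumes "m > 0" and "smooth U"
  shows
    "invariant_density (\<lambda>(q, P). heis_N q) (heis_field m U)
   \<and> (\<forall>(T :: real set) (q :: real \<Rightarrow> real^2) (P :: real \<Rightarrow> real^2). open T \<longrightarrow> is_interval T \<longrightarrow>
        (solves (heis_field m U) T (\<lambda>t. (q t, P t)) \<longleftrightarrow>
         solves (conformal_field heis_N (heis_H m U)) T (\<lambda>t. (q t, heis_N (q t) *\<^sub>R P t))))
   \<and> (\<forall>q :: real^2. q \<noteq> 0 \<longrightarrow>
        (\<exists>!x :: real^2. 0 < x$1 \<and> x$1 < pi/2 \<and> 0 \<le> x$2 \<and> x$2 < 2*pi \<and> q = central_proj x))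
   \<and> (\<forall>(q :: real^2) (\<theta> :: real) (\<phi> :: real) (p :: real^2) (p\<^sub>\<theta> :: real) (p\<^sub>\<phi> :: real).
        q \<noteq> 0 \<longrightarrow> 0 < \<theta> \<longrightarrow> \<theta> < pi/2 \<longrightarrow> 0 \<le> \<phi> \<longrightarrow> \<phi> < 2*pi \<longrightarrow>
        q = central_proj (vector [\<theta>, \<phi>]) \<longrightarrow>
        p\<^sub>\<theta> = (1 + (q$1)\<^sup>2 + (q$2)\<^sup>2) / sqrt ((q$1)\<^sup>2 + (q$2)\<^sup>2) * (q$1 * p$1 + q$2 * p$2) \<longrightarrow>
        p\<^sub>\<phi> = q$1 * p$2 - q$2 * p$1 \<longrightarrow>
          conjugate_momenta central_proj (vector [\<theta>, \<phi>]) p (vector [p\<^sub>\<theta>, p\<^sub>\<phi>])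
        \<and> heis_H m U q p =
            p\<^sub>\<theta>\<^sup>2 / (2 * m) + p\<^sub>\<phi>\<^sup>2 / (2 * m * (sin \<theta>)\<^sup>2) + U (central_proj (vector [\<theta>, \<phi>]))
        \<and> heis_H m U q p =
            hamiltonian (sphere_lagrangian m (U \<circ> central_proj)) (vector [\<theta>, \<phi>]) (vector [p\<^sub>\<theta>, p\<^sub>\<phi>]))"
proof (intro conjI allI impI)
  fix q p :: "real^2" and \<theta> \<phi> p\<^sub>\<theta> p\<^sub>\<phi> :: real
  assume \<theta>: "0 < \<theta>" "\<theta> < pi/2"
    and q: "q = central_proj (vector [\<theta>, \<phi>])"
    and p\<theta>: "p\<^sub>\<theta> = (1 + (q$1)\<^sup>2 + (q$2)\<^sup>2) / sqrt ((q$1)\<^sup>2 + (q$2)\<^sup>2) * (q$1 * p$1 + q$2 * p$2)"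
    and p\<phi>: "p\<^sub>\<phi> = q$1 * p$2 - q$2 * p$1"
  have pos: "cos \<theta> > 0" "sin \<theta> > 0" "tan \<theta> > 0"
    using \<theta> by (auto intro: cos_gt_zero sin_gt_zero2 tan_gt_zero)
  have r: "(q$1)\<^sup>2 + (q$2)\<^sup>2 = (tan \<theta>)\<^sup>2"
    by (simp add: q central_proj_norm)
  have sec: "1 + (tan \<theta>)\<^sup>2 = 1 / (cos \<theta>)\<^sup>2"
    using tan_sec[of \<theta>] pos by (simp add: divide_inverse power_inverse)
  have dot: "q$1 * p$1 + q$2 * p$2 = tan \<theta> * (p$1 * cos \<phi> + p$2 * sin \<phi>)"
    by (simp add: q central_proj_def algebra_simps)
  have p\<theta>': "p\<^sub>\<theta> = (p$1 * cos \<phi> + p$2 * sin \<phi>) / (cos \<theta>)\<^sup>2"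
    \<comment> \<open>Positivity of tan \<theta> identifies the square root of its square with tan
      \<theta>, which cancels against the factor in \<open>dot\<close>.\<close>
    using pos unfolding p\<theta> add.assoc r sec dot by simp
  have p\<phi>': "p\<^sub>\<phi> = tan \<theta> * (p$2 * cos \<phi> - p$1 * sin \<phi>)"
    by (simp add: p\<phi> q central_proj_def algebra_simps)
  show "conjugate_momenta central_proj (vector [\<theta>, \<phi>]) p (vector [p\<^sub>\<theta>, p\<^sub>\<phi>])"
    using conjugate_momenta_central_proj[of "vector [\<theta>, \<phi>]" p] pos by (simp add: p\<theta>' p\<phi>')
  show H: "heis_H m U q p =
      p\<^sub>\<theta>\<^sup>2 / (2 * m) + p\<^sub>\<phi>\<^sup>2 / (2 * m * (sin \<theta>)\<^sup>2) + U (central_proj (vector [\<theta>, \<phi>]))"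
    using heis_H_spherical[of "vector [\<theta>, \<phi>]" m U p] pos by (simp add: q p\<theta>' p\<phi>')
  show "heis_H m U q p =
      hamiltonian (sphere_lagrangian m (U \<circ> central_proj)) (vector [\<theta>, \<phi>]) (vector [p\<^sub>\<theta>, p\<^sub>\<phi>])"
    unfolding H using hamiltonian_sphere[of m "vector [\<theta>, \<phi>]"] pos assms(1) by simp
qed (simp_all only: assms heis_invariant_density heis_solves_iff, rule central_proj_bij)

end
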